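(* Let $F_2(x)=\sum_{n=1}^\infty \frac{\sigma_1(n)}{n^3}\sin(2\pi n x)$. For every $x\in(0,1)\setminus\mathbb{Q}$ there exist constants $C_1,C_2$ depending only on $x$ such that for all $y\in(0,1)$, $$|F_2(x)-F_2(y)|\le C_1|x-y|\log\Big(\frac{1}{|x-y|}\Big)+C_2|x-y|.$$
   Context: $\sigma_1(n)=\sum_{d\mid n}d$. The convention $0\cdot\infty=0$ is used (so the right-hand side is $0$ when $y=x$). *)

theory Defs
  imports "HOL-Analysis.Analysis"
begin

definition sigma1 :: "nat \<Rightarrow> nat" where
  "sigma1 n = \<Sum>{d. d dvd n}"

text \<open>
  The summation index is shifted by one, so that the series starts at \<open>n = 1\<close>.  Since
  \<open>sigma1 n \<le> n * (1 + ln n)\<close> for positive \<open>n\<close>, the series converges absolutely for every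
  real \<open>x\<close>.
\<close>
definition F2 :: "real \<Rightarrow> real" where
  "F2 x = (\<Sum>n. real (sigma1 (Suc n)) / real (Suc n) ^ 3 * sin (2 * pi * real (Suc n) * x))"

end

(* With T(N) = sigma1(1) + ... + sigma1(N) \<le> N^2, summation by parts shows that the sum of
   sigma1(n)/n^2 over n \<le> N is at most 1 + 2 ln N, and that the sum of sigma1(n)/n^3 over
   n > N is at most 3/N.  Split the series for F2 x - F2 y at N = floor (1/|x - y|), bounding
   the difference of the sines by 2 pi n |x - y| below N and by 2 above. *)

theory Submission
  imports Defs
begin

text \<open>After swapping the two summations, each \<open>d\<close> in \<open>{1..N}\<close> is
  counted once for each of its at most \<open>N div d\<close> multiples in the range, so it
  contributes at most \<open>N\<close>.\<close>

lemma sum_sigma1_le: "(\<Sum>n\<in>{1..N}. sigma1 n) \<le> N\<^sup>2"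
proof -
  \<comment> \<open>Both variables must range over fixed finite sets for the swap.\<close>
  have divs: "{d. d dvd n} = {d \<in> {1..N}. d dvd n}" if "n \<in> {1..N}" for n
    using that by (auto simp: Suc_le_eq dest: dvd_imp_le intro: dvd_pos_nat)
  have "(\<Sum>n\<in>{1..N}. sigma1 n) = (\<Sum>n\<in>{1..N}. \<Sum>d\<in>{d \<in> {1..N}. d dvd n}. d)"
    unfolding sigma1_def by (intro sum.cong refl) (simp only: divs)
  also have "\<dots> = (\<Sum>d\<in>{1..N}. \<Sum>n\<in>{n \<in> {1..N}. d dvd n}. d)"
    by (rule sum.swap_restrict) auto
  also have "\<dots> \<le> (\<Sum>d\<in>{1..N}. N)"
  proof (rule sum_mono)
    fix d assume d: "d \<in> {1..N}"
    have "{n \<in> {1..N}. d dvd n} \<subseteq> (*) d ` {1..N div d}"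
    proof
      fix n assume n: "n \<in> {n \<in> {1..N}. d dvd n}"
      then obtain k where k: "n = d * k" by auto
      with n d have "k \<in> {1..N div d}"
        by (auto simp: less_eq_div_iff_mult_less_eq mult.commute Suc_le_eq)
      with k show "n \<in> (*) d ` {1..N div d}" by blast
    qed
    then have "card {n \<in> {1..N}. d dvd n} \<le> N div d"
      using surj_card_le[of "{1..N div d}"] by fastforce
    then have "card {n \<in> {1..N}. d dvd n} * d \<le> N div d * d"
      by (rule mult_right_mono) simp
    also have "\<dots> \<le> N" by simp
    finally show "(\<Sum>n\<in>{n \<in> {1..N}. d dvd n}. d) \<le> N" by simp
  qed
  finally show ?thesis by (simp add: power2_eq_square)
qed

lemma sum_sigma1_Suc_le: "(\<Sum>n<N. real (sigma1 (Suc n))) \<le> (real N)\<^sup>2"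
proof -
  have "(\<Sum>n<N. sigma1 (Suc n)) = (\<Sum>n\<in>{1..N}. sigma1 n)"
    by (rule sum.reindex_bij_witness[of _ "\<lambda>n. n - 1" Suc]) auto
  with sum_sigma1_le[of N] have "real (\<Sum>n<N. sigma1 (Suc n)) \<le> real (N\<^sup>2)"
    by (simp only: of_nat_le_iff)
  then show ?thesis by simp
qed

lemma sum_sigma1_div_square_le:
  assumes "N \<ge> 1"
  shows "(\<Sum>n<N. real (sigma1 (Suc n)) / real (Suc n) ^ 2) \<le> 1 + 2 * ln (real N)"
proof -
  let ?T = "\<lambda>N. \<Sum>n<N. real (sigma1 (Suc n))"
  \<comment> \<open>With the boundary term subtracted, the new summand cancels in the induction step
    and the increment is exactly \<open>?T N * (1/N^2 - 1/(N+1)^2)\<close>. The boundary term itself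
    is at most 1.\<close>
  have "(\<Sum>n<N. real (sigma1 (Suc n)) / real (Suc n) ^ 2) - ?T N / real N ^ 2
      \<le> 2 * ln (real N)"
    using assms
  proof (induction N rule: dec_induct)
    case (step N)
    define r where "r = real N"
    have r: "r \<ge> 1" using step by (simp add: r_def)
    have "?T N / r\<^sup>2 - ?T N / (r + 1)\<^sup>2 = ?T N * ((2 * r + 1) / (r\<^sup>2 * (r + 1)\<^sup>2))"
      using r by (simp add: divide_simps) algebra
    also have "\<dots> \<le> r\<^sup>2 * ((2 * r + 1) / (r\<^sup>2 * (r + 1)\<^sup>2))"
      using sum_sigma1_Suc_le[of N] r by (intro mult_right_mono) (auto simp: r_def)
    also have "\<dots> = (2 * r + 1) / (r + 1)\<^sup>2"
      using r by (simp add: divide_simps)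
    also have "\<dots> \<le> 2 * (r + 1) / (r + 1)\<^sup>2"
      using r by (intro divide_right_mono) auto
    also have "\<dots> = 2 / (r + 1)"
      using r by (simp add: divide_simps power2_eq_square)
    \<comment> \<open>This is \<open>ln t \<le> t - 1\<close> at \<open>t = r / (r + 1)\<close>; the
      right-hand side telescopes.\<close>
    also have "2 / (r + 1) \<le> 2 * ln (r + 1) - 2 * ln r"
    proof -
      have "ln (r / (r + 1)) \<le> r / (r + 1) - 1"
        using r by (intro ln_le_minus_one) auto
      also have "\<dots> = - 1 / (r + 1)"
        using r by (simp add: field_simps)
      finally show ?thesis
        using r by (simp add: ln_div)
    qed
    finally have "?T N / r\<^sup>2 - ?T N / (r + 1)\<^sup>2 \<le> 2 * ln (r + 1) - 2 * ln r" .
    with step.IH show ?case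
      by (simp add: r_def add_divide_distrib add.commute)
  qed simp
  moreover have "?T N / real N ^ 2 \<le> 1"
    using sum_sigma1_Suc_le[of N] assms by (simp add: divide_simps)
  ultimately show ?thesis by simp
qed

text \<open>Summation by parts again, with increments bounded by the telescoping
  \<open>3 / r - 3 / (r + 1)\<close>. The boundary term at the upper end is at most
  \<open>1 / (M + N)\<close> and is absorbed by the leftover \<open>- 3 / (M + N)\<close>, which
  makes the bound uniform in \<open>M\<close>.\<close>

lemma sum_sigma1_div_cube_tail_le:
  assumes "N \<ge> 1"
  shows "(\<Sum>n<M. real (sigma1 (Suc (n + N))) / real (Suc (n + N)) ^ 3) \<le> 3 / real N"
proof -
  let ?T = "\<lambda>N. \<Sum>n<N. real (sigma1 (Suc n))"
  have "(\<Sum>n<M. real (sigma1 (Suc (n + N))) / real (Suc (n + N)) ^ 3)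
      - ?T (M + N) / real (M + N) ^ 3 \<le> 3 / real N - 3 / real (M + N)"
  proof (induction M)
    case 0
    show ?case by (simp add: sum_nonneg)
  next
    case (Suc M)
    define r where "r = real (M + N)"
    have r: "r \<ge> 1" using assms by (simp add: r_def)
    have "?T (M + N) / r ^ 3 - ?T (M + N) / (r + 1) ^ 3
        = ?T (M + N) * ((3 * r\<^sup>2 + 3 * r + 1) / (r ^ 3 * (r + 1) ^ 3))"
      using r by (simp add: divide_simps) algebra
    also have "\<dots> \<le> r\<^sup>2 * ((3 * r\<^sup>2 + 3 * r + 1) / (r ^ 3 * (r + 1) ^ 3))"
      using sum_sigma1_Suc_le[of "M + N"] r by (intro mult_right_mono) (auto simp: r_def)
    also have "\<dots> = (3 * r\<^sup>2 + 3 * r + 1) / (r * (r + 1) ^ 3)"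
      using r by (simp add: divide_simps power2_eq_square power3_eq_cube)
    \<comment> \<open>The numerator is enlarged so that the quotient becomes
      \<open>3 / (r * (r + 1))\<close>, whose partial fractions telescope.\<close>
    also have "\<dots> \<le> 3 * (r + 1)\<^sup>2 / (r * (r + 1) ^ 3)"
      using r by (intro divide_right_mono) (simp_all add: power2_eq_square algebra_simps)
    also have "\<dots> = 3 / r - 3 / (r + 1)"
      using r by (simp add: divide_simps) algebra
    finally have "?T (M + N) / r ^ 3 - ?T (M + N) / (r + 1) ^ 3 \<le> 3 / r - 3 / (r + 1)" .
    with Suc.IH show ?case
      by (simp add: r_def add_divide_distrib add_ac)
  qed
  moreover have "?T (M + N) / real (M + N) ^ 3 \<le> 1 / real (M + N)"
  proof -
    have "?T (M + N) / real (M + N) ^ 3 \<le> real (M + N) ^ 2 / real (M + N) ^ 3"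
      by (intro divide_right_mono sum_sigma1_Suc_le) auto
    also have "\<dots> = 1 / real (M + N)"
      by (simp add: power2_eq_square power3_eq_cube)
    finally show ?thesis .
  qed
  moreover have "1 / real (M + N) \<le> 3 / real (M + N)"
    by (intro divide_right_mono) auto
  ultimately show ?thesis by linarith
qed

lemma summable_sigma1_div_cube: "summable (\<lambda>n. real (sigma1 (Suc n)) / real (Suc n) ^ 3)"
proof -
  \<comment> \<open>The tail bound requires \<open>N \<ge> 1\<close>, so the first term is dropped;
    at \<open>N = 1\<close> all partial sums are at most 3.\<close>
  have "summable (\<lambda>n. real (sigma1 (Suc (n + 1))) / real (Suc (n + 1)) ^ 3)"
    by (rule bounded_imp_summable[where B = 3])
      (use sum_sigma1_div_cube_tail_le[of 1 "Suc _"] in \<open>auto simp: lessThan_Suc_atMost\<close>)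
  then show ?thesis
    by (subst (asm) summable_iff_shift)
qed

lemma abs_sin_diff_le: "\<bar>sin a - sin b\<bar> \<le> \<bar>a - b\<bar>" for a b :: real
proof -
  have "\<bar>sin a - sin b\<bar> = 2 * \<bar>sin ((a - b) / 2)\<bar> * \<bar>cos ((a + b) / 2)\<bar>"
    by (simp add: sin_diff_sin abs_mult)
  also have "\<dots> \<le> 2 * \<bar>(a - b) / 2\<bar> * 1"
    by (intro mult_mono abs_sin_x_le_abs_x) auto
  finally show ?thesis by simp
qed

text \<open>The terms below the cut contribute \<open>2 * pi * h * (1 + 2 * ln (1 / h))\<close> with
  \<open>h = \<bar>x - y\<bar>\<close>, the tail contributes \<open>12 * h\<close>.\<close>

lemma F2_modulus_of_continuity:
  assumes "\<bar>x - y\<bar> < 1"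
  shows "\<bar>F2 x - F2 y\<bar>
    \<le> 4 * pi * \<bar>x - y\<bar> * ln (1 / \<bar>x - y\<bar>) + (2 * pi + 12) * \<bar>x - y\<bar>"
proof (cases "x = y")
  case False
  define h where "h = \<bar>x - y\<bar>"
  have h: "0 < h" "h < 1" using assms False by (auto simp: h_def)
  \<comment> \<open>\<open>h < 1\<close> gives \<open>N \<ge> 1\<close>. The upper bound
    \<open>N \<le> 1 / h\<close> controls the logarithm, the lower bound
    \<open>1 / h < N + 1\<close> controls the tail.\<close>
  define N where "N = nat \<lfloor>1 / h\<rfloor>"
  have N: "N \<ge> 1" "real N \<le> 1 / h" "1 / h < real N + 1"
    using h real_of_int_floor_add_one_gt[of "1 / h"]
    by (simp_all add: N_def le_nat_iff le_floor_iff del: real_of_int_floor_add_one_gt)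
  define a where "a = (\<lambda>n. real (sigma1 (Suc n)) / real (Suc n) ^ 3)"
  define D where "D = (\<lambda>n. a n * (sin (2 * pi * real (Suc n) * x) - sin (2 * pi * real (Suc n) * y)))"
  have a_nonneg: "a n \<ge> 0" for n by (simp add: a_def)
  have sum_a: "summable a"
    using summable_sigma1_div_cube by (simp add: a_def)
  have D_le2: "\<bar>D n\<bar> \<le> 2 * a n" for n
  proof -
    have "\<bar>sin (2 * pi * real (Suc n) * x) - sin (2 * pi * real (Suc n) * y)\<bar> \<le> 1 + 1"
      by (intro order_trans[OF abs_triangle_ineq4] add_mono abs_sin_le_one)
    from mult_left_mono[OF this a_nonneg[of n]] show ?thesis
      by (simp add: D_def abs_mult a_nonneg mult.commute)
  qed
  \<comment> \<open>The Lipschitz bound for the sine costs one factor \<open>Suc n\<close>, turning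
    the cube into a square.\<close>
  have D_le: "\<bar>D n\<bar> \<le> 2 * pi * h * (real (sigma1 (Suc n)) / real (Suc n) ^ 2)" for n
  proof -
    have "\<bar>D n\<bar> \<le> a n * \<bar>2 * pi * real (Suc n) * x - 2 * pi * real (Suc n) * y\<bar>"
      unfolding D_def abs_mult using a_nonneg[of n]
      by (simp only: abs_of_nonneg) (intro mult_left_mono abs_sin_diff_le)
    also have "2 * pi * real (Suc n) * x - 2 * pi * real (Suc n) * y = 2 * pi * real (Suc n) * (x - y)"
      by (simp only: right_diff_distrib)
    also have "a n * \<bar>2 * pi * real (Suc n) * (x - y)\<bar> = 2 * pi * h * (a n * real (Suc n))"
      by (simp add: abs_mult h_def)
    also have "a n * real (Suc n) = real (sigma1 (Suc n)) / real (Suc n) ^ 2"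
      unfolding a_def by (simp add: power2_eq_square power3_eq_cube del: of_nat_Suc)
    finally show ?thesis .
  qed
  have sum_abs_D: "summable (\<lambda>n. \<bar>D n\<bar>)"
    by (rule summable_comparison_test'[OF summable_mult[OF sum_a, of 2], of 0])
      (use D_le2 in auto)
  have sum_sin: "summable (\<lambda>n. a n * sin (2 * pi * real (Suc n) * z))" for z
    by (rule summable_comparison_test'[OF sum_a, of 0])
      (auto simp: abs_mult a_nonneg intro!: mult_left_le)
  have "F2 x - F2 y = suminf D"
    unfolding F2_def D_def right_diff_distrib using suminf_diff[OF sum_sin sum_sin]
    by (simp add: a_def)
  then have "\<bar>F2 x - F2 y\<bar> \<le> (\<Sum>n. \<bar>D n\<bar>)"
    using summable_rabs[OF sum_abs_D] by simp
  also have "\<dots> = (\<Sum>n. \<bar>D (n + N)\<bar>) + (\<Sum>n<N. \<bar>D n\<bar>)"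
    by (rule suminf_split_initial_segment[OF sum_abs_D])
  also have "(\<Sum>n. \<bar>D (n + N)\<bar>) \<le> 12 * h"
  proof (rule suminf_le_const)
    show "summable (\<lambda>n. \<bar>D (n + N)\<bar>)"
      using sum_abs_D by (subst summable_iff_shift)
    fix M
    have "(\<Sum>n<M. \<bar>D (n + N)\<bar>) \<le> 2 * (\<Sum>n<M. a (n + N))"
      unfolding sum_distrib_left by (intro sum_mono D_le2)
    also have "\<dots> \<le> 2 * (3 / real N)"
      using sum_sigma1_div_cube_tail_le[OF N(1), of M] by (simp add: a_def)
    also have "\<dots> \<le> 12 * h"
    proof -
      \<comment> \<open>Since \<open>1 / h < N + 1 \<le> 2 * N\<close>, the tail bound
        \<open>6 / N\<close> is at most \<open>12 * h\<close>.\<close>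
      have "1 / h \<le> 2 * real N" using N by simp
      then show ?thesis using h N(1) by (simp add: field_simps)
    qed
    finally show "(\<Sum>n<M. \<bar>D (n + N)\<bar>) \<le> 12 * h" .
  qed
  also have "(\<Sum>n<N. \<bar>D n\<bar>) \<le> 2 * pi * h * (1 + 2 * ln (1 / h))"
  proof -
    have "(\<Sum>n<N. \<bar>D n\<bar>) \<le> 2 * pi * h * (\<Sum>n<N. real (sigma1 (Suc n)) / real (Suc n) ^ 2)"
      unfolding sum_distrib_left by (intro sum_mono D_le)
    also have "\<dots> \<le> 2 * pi * h * (1 + 2 * ln (real N))"
      using h by (intro mult_left_mono sum_sigma1_div_square_le N) auto
    also have "\<dots> \<le> 2 * pi * h * (1 + 2 * ln (1 / h))"
      using h N by (intro mult_left_mono add_left_mono) (auto intro!: ln_mono)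
    finally show ?thesis .
  qed
  finally show ?thesis
    unfolding h_def by (simp add: algebra_simps)
\<comment> \<open>For \<open>x = y\<close> both sides are 0, since the factor
  \<open>\<bar>x - y\<bar>\<close> vanishes whatever value the logarithm takes.\<close>
qed simp

theorem theorem1p4:
  fixes x :: real
  assumes "x \<in> {0<..<1} - \<rat>"
  shows "\<exists>C1 C2 :: real. \<forall>y \<in> {0<..<1}.
           \<bar>F2 x - F2 y\<bar> \<le> C1 * \<bar>x - y\<bar> * ln (1 / \<bar>x - y\<bar>) + C2 * \<bar>x - y\<bar>"
  \<comment> \<open>Two points of (0,1) lie at distance less than 1.\<close>
  using assms F2_modulus_of_continuity[of x]
  by (intro exI[of _ "4 * pi"] exI[of _ "2 * pi + 12"]) auto

end
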